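(* Let $\boldsymbol w\in\{0,1\}^\omega$. Then $\varphi(\boldsymbol w)$ is faux-bonacci if and only if $\boldsymbol w$ is faux-bonacci.
   Context: Words are over the binary alphabet $\{0,1\}$; an $\omega$-word is an infinite word indexed by the positive integers. $\varphi$ is the morphism $\varphi(0)=01$, $\varphi(1)=0$. For a non-empty word $X$, $X^-$ denotes $X$ with its last letter erased. A $4^-$-power is a word $XXXX^-$ with $X$ non-empty. A binary word is faux-bonacci if it contains no factor $11$ and no factor that is a $4^-$-power. *)

theory Defs
  imports "HOL-Library.Stream" "HOL-Library.Z2"
begin

text \<open>Letters are the elements \<open>0\<close>, \<open>1\<close> of the two-element type \<^typ>\<open>bit\<close> (its field structure is not
  used); finite words are lists and \<open>\<omega>\<close>-words are streams.\<close>

fun phi_letter :: "bit \<Rightarrow> bit list" where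
  "phi_letter a = (if a = 0 then [0, 1] else [0])"

definition phi_word :: "bit list \<Rightarrow> bit list" where
  "phi_word u = concat (map phi_letter u)"

text \<open>\<^const>\<open>flat\<close> is infinite concatenation provided that all the blocks are non-empty, as they are
  here; \<open>phi_omega_shift\<close> below confirms that this is the extension of the morphism to
  \<open>\<omega>\<close>-words.\<close>

definition phi_omega :: "bit stream \<Rightarrow> bit stream" where
  "phi_omega w = flat (smap phi_letter w)"

lemma phi_omega_shift: "phi_omega (u @- w) = phi_word u @- phi_omega w"
  by (induction u) (simp_all add: phi_omega_def phi_word_def)

definition factor :: "'a list \<Rightarrow> 'a stream \<Rightarrow> bool" where
  "factor u w \<longleftrightarrow> (\<exists>p s. w = p @- u @- s)"

definition four_minus_power :: "'a list \<Rightarrow> bool" where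
  "four_minus_power u \<longleftrightarrow> (\<exists>X. X \<noteq> [] \<and> u = X @ X @ X @ butlast X)"

definition faux_bonacci :: "bit stream \<Rightarrow> bool" where
  "faux_bonacci w \<longleftrightarrow> \<not> factor [1, 1] w \<and> \<not> (\<exists>u. factor u w \<and> four_minus_power u)"

end

theory Submission
  imports Defs
begin

text \<open>In \<open>\<phi>(w)\<close> the blocks \<open>\<phi>(a)\<close> begin exactly at the occurrences of \<open>0\<close>, so a factor that starts with
  \<open>0\<close> and is followed by \<open>0\<close> is the image of a unique factor of \<open>w\<close>. If \<open>YYYY\<^sup>-\<close> occurs in
  \<open>\<phi>(w)\<close> with \<open>Y\<close> starting with \<open>0\<close>, then \<open>Y = \<phi>(X)\<close> and the occurrence decodes to \<open>XXXX\<^sup>-\<close>, the only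
  possible obstruction at its end being a factor \<open>11\<close> of \<open>w\<close>. If \<open>Y\<close> starts with \<open>1\<close>, then it
  ends with \<open>0\<close> and the occurrence is preceded by \<open>0\<close>, so shifting it to the left by one letter
  reduces to the first case. Conversely, \<open>\<phi>(X)\<^sup>-\<close> is a prefix of \<open>\<phi>(X\<^sup>-)0\<close>, and the image of every
  suffix of \<open>w\<close> starts with \<open>0\<close>, so \<open>XXXX\<^sup>-\<close> in \<open>w\<close> yields \<open>\<phi>(X)\<phi>(X)\<phi>(X)\<phi>(X)\<^sup>-\<close> in \<open>\<phi>(w)\<close>, and
  \<open>11\<close> yields \<open>000\<close>.\<close>

section \<open>Decoding images block by block\<close>

lemma phi_omega_Cons: "phi_omega (a ## w) = phi_letter a @- phi_omega w"
  by (simp add: phi_omega_def)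

lemma phi_word_simps [simp]:
  "phi_word [] = []"
  "phi_word (a # u) = phi_letter a @ phi_word u"
  "phi_word (u @ v) = phi_word u @ phi_word v"
  by (simp_all add: phi_word_def)

lemma shd_phi_omega [simp]: "shd (phi_omega w) = 0"
  by (cases w) (simp add: phi_omega_Cons)

lemma phi_omega_conv_0: "\<exists>s. phi_omega w = 0 ## s"
  by (metis shd_phi_omega stream.collapse)

lemma phi_word_eq_Nil [simp]: "phi_word u = [] \<longleftrightarrow> u = []"
  by (cases u) auto

lemma phi_word_neq_1: "phi_word u \<noteq> 1 # v"
  by (cases u) auto

text \<open>No image starts with \<open>1\<close>, so whether a \<open>1\<close> follows the leading
  \<open>0\<close> determines the first block.\<close>

lemma inj_phi_word: "phi_word u = phi_word v \<Longrightarrow> u = v"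
proof (induction u arbitrary: v)
  case Nil
  then show ?case by (metis phi_word_eq_Nil phi_word_simps(1))
next
  case (Cons a u)
  then obtain b v' where v: "v = b # v'"
    by (cases v) (auto split: if_splits)
  have "a = b \<and> phi_word u = phi_word v'"
    using Cons.prems phi_word_neq_1[of u] phi_word_neq_1[of v'] unfolding v
    by (cases a; cases b) (auto dest: sym)
  with Cons.IH v show ?case by simp
qed

text \<open>Only the block \<open>01\<close> has an interior cut. The induction peels one block off
  \<open>p\<close> at a time.\<close>

lemma phi_omega_split:
  assumes "phi_omega w = p @- s"
  obtains (boundary) u v where "w = u @- v" "p = phi_word u" "s = phi_omega v"
  | (inside) u v where "w = u @- 0 ## v" "p = phi_word u @ [0]" "s = 1 ## phi_omega v"
proof -
  have "(\<exists>u v. w = u @- v \<and> p = phi_word u \<and> s = phi_omega v) \<or>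
    (\<exists>u v. w = u @- 0 ## v \<and> p = phi_word u @ [0] \<and> s = 1 ## phi_omega v)"
    using assms
  proof (induction "length p" arbitrary: p w rule: less_induct)
    case less
    obtain a v where w: "w = a ## v" by (cases w)
    consider "p = []" | "a = 0" "p = [0]" "s = 1 ## phi_omega v"
      | p' where "p = phi_letter a @ p'" "phi_omega v = p' @- s"
    proof (cases "a = 0")
      case True
      show thesis
      proof (cases p)
        case (Cons x p')
        with True less.prems w that show thesis
          by (cases p') (auto simp: phi_omega_Cons)
      qed (use that in simp)
    next
      case False
      with less.prems w that show thesis
        by (cases p) (auto simp: phi_omega_Cons)
    qed
    then show ?case
    proof cases
      case 1
      then have "w = [] @- w \<and> p = phi_word [] \<and> s = phi_omega w"
        using less.prems by simp
      then show ?thesis by blast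
    next
      case 2
      then have "w = [] @- 0 ## v \<and> p = phi_word [] @ [0] \<and> s = 1 ## phi_omega v"
        using w by simp
      then show ?thesis by blast
    next
      case 3
      then have "length p' < length p" by simp
      from less.hyps[OF this 3(2)] show ?thesis
      proof (elim disjE exE conjE)
        fix u v' assume "v = u @- v'" "p' = phi_word u" "s = phi_omega v'"
        then have "w = (a # u) @- v' \<and> p = phi_word (a # u) \<and> s = phi_omega v'"
          using w 3 by simp
        then show ?thesis by blast
      next
        fix u v' assume "v = u @- 0 ## v'" "p' = phi_word u @ [0]" "s = 1 ## phi_omega v'"
        then have "w = (a # u) @- 0 ## v' \<and> p = phi_word (a # u) @ [0] \<and> s = 1 ## phi_omega v'"
          using w 3 by simp
        then show ?thesis by blast
      qed
    qed
  qed
  with that show thesis by blast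
qed

lemma phi_omega_decode:
  assumes "phi_omega w = p @- s" "shd s = 0"
  obtains u v where "w = u @- v" "p = phi_word u" "s = phi_omega v"
  using assms by (auto elim: phi_omega_split)

lemma phi_omega_decode_word:
  assumes "phi_omega w = phi_word u @- s" "shd s = 0"
  obtains v where "w = u @- v" "s = phi_omega v"
  using assms by (metis phi_omega_decode inj_phi_word)

text \<open>A \<open>1\<close> occurs only as the second letter of a block \<open>01\<close>, and
  the next block starts with \<open>0\<close>.\<close>

lemma phi_omega_around_1:
  assumes "phi_omega w = p @- 1 ## s"
  shows "shd s = 0" "\<exists>q. p = q @ [0]"
  using assms by (auto elim!: phi_omega_split dest: arg_cong[where f = shd])

lemma not_factor_11_phi_omega: "\<not> factor [1, 1] (phi_omega w)"
  using phi_omega_around_1(1) by (fastforce simp: factor_def)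

text \<open>Each of the first two zeros is followed by \<open>0\<close>, hence is a whole block, the
  image of \<open>1\<close>.\<close>

lemma factor_11_if_factor_000:
  assumes "phi_omega w = p @- 0 ## 0 ## 0 ## s"
  shows "factor [1, 1] w"
proof -
  obtain u v where uv: "w = u @- v" "0 ## 0 ## 0 ## s = phi_omega v"
    using phi_omega_decode[OF assms] by (metis stream.sel(1))
  have "phi_omega v = phi_word [1, 1] @- 0 ## s"
    using uv by simp
  then obtain v' where "v = [1, 1] @- v'"
    by (rule phi_omega_decode_word) auto
  with uv show ?thesis unfolding factor_def by blast
qed

section \<open>From powers in the word to powers in its image\<close>

lemma factor_phi_omega_if_factor:
  assumes "factor u w" "four_minus_power u"
  shows "\<exists>u'. factor u' (phi_omega w) \<and> four_minus_power u'"
proof -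
  obtain X p s where X: "X \<noteq> []" and w: "w = p @- (X @ X @ X @ butlast X) @- s"
    using assms by (auto simp: factor_def four_minus_power_def)
  obtain Z a where Z: "X = Z @ [a]"
    using X by (metis append_butlast_last_id)
  obtain t where t: "phi_omega s = 0 ## t"
    using phi_omega_conv_0 by blast
  let ?Y = "phi_word X"
  have "\<exists>r. phi_word Z @- phi_omega s = butlast ?Y @- r"
  proof (cases "a = 0")
    case True
    then have "phi_word Z @- phi_omega s = butlast ?Y @- t"
      by (simp add: Z t butlast_append)
    then show ?thesis ..
  qed (auto simp: Z butlast_append)
  then obtain r where "phi_word Z @- phi_omega s = butlast ?Y @- r" ..
  then have "phi_omega w = phi_word p @- (?Y @ ?Y @ ?Y @ butlast ?Y) @- r"
    by (simp add: w phi_omega_shift phi_omega_Cons Z)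
  moreover have "?Y \<noteq> []"
    using X by simp
  ultimately show ?thesis
    unfolding factor_def four_minus_power_def by blast
qed

section \<open>From powers in the image back to the word\<close>

lemma not_faux_bonacci_if_power_starting_with_0:
  assumes w: "phi_omega w = p @- (Y @ Y @ Y @ butlast Y) @- s" and Y: "Y = 0 # Y'"
  shows "\<not> faux_bonacci w"
proof (cases "Y' = []")
  case True
  then show ?thesis
    using factor_11_if_factor_000[of w p s] w Y by (simp add: faux_bonacci_def)
next
  case False
  obtain u v where v: "w = u @- v" "phi_omega v = Y @- Y @- Y @- butlast Y @- s"
  proof (rule phi_omega_decode)
    show "phi_omega w = p @- Y @- Y @- Y @- butlast Y @- s" using w by simp
  qed (use Y in auto)
  obtain X v' where X: "v = X @- v'" "Y = phi_word X" "phi_omega v' = Y @- Y @- butlast Y @- s"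
    using v(2) by (rule phi_omega_decode) (use Y in auto)
  have "phi_omega v' = phi_word (X @ X) @- butlast Y @- s"
    using X by simp
  \<comment> \<open>\<open>Y\<close> has at least two letters here, so \<open>butlast Y\<close>
    keeps its leading \<open>0\<close>.\<close>
  moreover have "shd (butlast Y @- s) = 0"
    using False by (simp add: Y)
  ultimately obtain v3 where v3: "v' = (X @ X) @- v3" "phi_omega v3 = butlast Y @- s"
    by (metis phi_omega_decode_word)
  have w3: "w = u @- (X @ X @ X) @- v3"
    by (simp add: v X v3)
  obtain Z a where Z: "X = Z @ [a]"
    using X Y by (metis append_butlast_last_id list.distinct(1) phi_word_eq_Nil)
  have "factor [1, 1] w \<or> (\<exists>r. v3 = Z @- r)"
  \<comment> \<open>If \<open>a = 0\<close>, then \<open>butlast Y\<close> is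
    \<open>phi_word Z @ [0]\<close>, whose final \<open>0\<close> marks a block boundary. Otherwise
    it is \<open>phi_word Z\<close>, and the last letter of \<open>Z\<close> decides.\<close>
  proof (cases "a = 0")
    case True
    then have "phi_omega v3 = phi_word Z @- 0 ## s"
      using v3 by (simp add: X(2) Z butlast_append)
    then show ?thesis
      by (metis phi_omega_decode_word stream.sel(1))
  next
    case a: False
    then have v3_eq: "phi_omega v3 = phi_word Z @- s"
      using v3 by (simp add: X(2) Z butlast_append)
    \<comment> \<open>\<open>X = [1]\<close> would give \<open>Y = [0]\<close>, the case treated
      first.\<close>
    have "Z \<noteq> []"
      using False a X(2) Y Z by auto
    then obtain T b where T: "Z = T @ [b]"
      by (metis append_butlast_last_id)
    show ?thesis
    proof (cases "b = 0")
      case True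
      then have "phi_omega v3 = (phi_word T @ [0]) @- 1 ## s"
        using v3_eq T by simp
      then have "shd s = 0"
        by (rule phi_omega_around_1)
      then show ?thesis
        by (metis v3_eq phi_omega_decode_word)
    next
      case False
      \<comment> \<open>The first copy of \<open>X\<close> already ends with
        \<open>11\<close>.\<close>
      then have "w = (u @ T) @- [1, 1] @- X @- X @- v3"
        using a w3 Z T by simp
      then show ?thesis
        unfolding factor_def by blast
    qed
  qed
  then show ?thesis
  proof
    assume "factor [1, 1] w"
    then show ?thesis by (simp add: faux_bonacci_def)
  next
    assume "\<exists>r. v3 = Z @- r"
    then obtain r where "w = u @- (X @ X @ X @ butlast X) @- r"
      using w3 Z by auto
    then have "factor (X @ X @ X @ butlast X) w"
      unfolding factor_def by blast
    moreover have "X \<noteq> []"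
      using Z by simp
    ultimately show ?thesis
      unfolding faux_bonacci_def four_minus_power_def by blast
  qed
qed

lemma not_faux_bonacci_if_factor_phi_omega:
  assumes "factor y (phi_omega w)" "four_minus_power y"
  shows "\<not> faux_bonacci w"
proof -
  obtain Y p s where "Y \<noteq> []" and w: "phi_omega w = p @- (Y @ Y @ Y @ butlast Y) @- s"
    using assms by (auto simp: factor_def four_minus_power_def)
  then obtain b Y' where Y: "Y = b # Y'"
    by (cases Y) auto
  show ?thesis
  proof (cases "b = 0")
    case True
    with w Y show ?thesis
      by (metis not_faux_bonacci_if_power_starting_with_0)
  next
    case False
    then have Y1: "Y = 1 # Y'"
      using Y by simp
    have "phi_omega w = p @- 1 ## Y' @- Y @- Y @- butlast Y @- s"
      using w Y1 by simp
    then obtain q where q: "p = q @ [0]"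
      by (metis phi_omega_around_1(2))
    \<comment> \<open>The second copy of \<open>Y\<close> starts with \<open>1\<close> too, so the
      first one ends with \<open>0\<close>.\<close>
    have "phi_omega w = (p @ Y) @- 1 ## Y' @- Y @- butlast Y @- s"
      using w Y1 by simp
    then obtain q' where "p @ Y = q' @ [0]"
      by (metis phi_omega_around_1(2))
    then have "last Y = 0"
      using \<open>Y \<noteq> []\<close> by (metis last_appendR last_snoc)
    then obtain Y2 where Y2: "Y = Y2 @ [0]"
      using \<open>Y \<noteq> []\<close> by (metis append_butlast_last_id)
    \<comment> \<open>Since \<open>butlast Y = Y2\<close>, the shift by one letter yields a full
      fourth power of the conjugate \<open>Z\<close>; its last letter is moved into
      \<open>r\<close>.\<close>
    define Z where "Z = 0 # Y2"
    obtain r where r: "Z @- s = butlast Z @- r"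
      unfolding Z_def by (metis append_butlast_last_id list.distinct(1) shift_append)
    have "phi_omega w = q @- Z @- Z @- Z @- Z @- s"
      using w q Y2 by (simp add: Z_def)
    then have "phi_omega w = q @- (Z @ Z @ Z @ butlast Z) @- r"
      using r by simp
    then show ?thesis
      using Z_def by (rule not_faux_bonacci_if_power_starting_with_0)
  qed
qed

theorem theorem6:
  fixes w :: "bit stream"
  shows "faux_bonacci (phi_omega w) \<longleftrightarrow> faux_bonacci w"
proof
  assume phi: "faux_bonacci (phi_omega w)"
  have "\<not> factor [1, 1] w"
  proof
    assume "factor [1, 1] w"
    then obtain p s where "w = p @- [1, 1] @- s"
      by (auto simp: factor_def)
    moreover obtain t where "phi_omega s = 0 ## t"
      using phi_omega_conv_0 by blast
    \<comment> \<open>As \<open>butlast [0]\<close> is empty, this power is \<open>000\<close>; its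
      third \<open>0\<close> opens the image of \<open>s\<close>.\<close>
    ultimately have "phi_omega w = phi_word p @- ([0] @ [0] @ [0] @ butlast [0]) @- t"
      by (simp add: phi_omega_shift phi_omega_Cons)
    then have "factor ([0] @ [0] @ [0] @ butlast [0]) (phi_omega w)"
      unfolding factor_def by blast
    with phi show False
      unfolding faux_bonacci_def four_minus_power_def by blast
  qed
  with phi show "faux_bonacci w"
    using factor_phi_omega_if_factor unfolding faux_bonacci_def by blast
next
  assume "faux_bonacci w"
  then show "faux_bonacci (phi_omega w)"
    using not_factor_11_phi_omega not_faux_bonacci_if_factor_phi_omega
    unfolding faux_bonacci_def by blast
qed

end
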